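(* Let $(P,\leq,{}',0,1)$ be a generalized orthomodular poset that is a horizontal sum of Boolean posets and let $a,b,c\in P$. Then $$t(a,b,c)=\begin{cases}c&\text{if }a\mathrel{\mathrm C}b,\\ a&\text{otherwise.}\end{cases}$$
   Context: For a poset $(P,\leq)$ and $A\subseteq P$ put $L(A)=\{x\in P\mid x\leq y\text{ for all }y\in A\}$ and $U(A)=\{x\in P\mid y\leq x\text{ for all }y\in A\}$; for elements or subsets separated by commas one takes the union, e.g. $L(a,b)=L(\{a,b\})$, $L(A,b)=L(A\cup\{b\})$, $U(A,B)=U(A\cup B)$, and $LU(A)=L(U(A))$. $\operatorname{Min}A$ is the set of minimal elements of $A$ and $\operatorname{Min}U(\cdot)$ means $\operatorname{Min}(U(\cdot))$. Singletons are identified with their unique element. A poset is distributive if $L(U(x,y),z)=LU(L(x,z),L(y,z))$ for all $x,y,z$. A unary operation $'$ on a bounded poset is a complementation if $L(x,x')=\{0\}$ and $U(x,x')=\{1\}$ for all $x$. A Boolean poset is a bounded distributive poset $(B,\leq,{}',0,1)$ with a complementation $'$ (then $'$ is automatically an antitone involution). A generalized orthomodular poset is a bounded poset $(P,\leq,{}',0,1)$ with an antitone involution $'$ that is a complementation and satisfies: $x\leq y$ implies $U(y)=U(x,L(y,x'))$. The horizontal sum of a non-empty family $(P_i,\leq,{}',0,1)$, $i\in I$, of bounded posets with an antitone involution is the poset $P$ that is the union of disjoint copies of the posets $P_i$ where the bottom elements of the $P_i$ are identified (to one element $0$) and the top elements of the $P_i$ are identified (to one element $1$); the order and $'$ are those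 inherited from the $P_i$. In a generalized orthomodular poset $(P,\leq,{}',0,1)$: $x\mathrel{\mathrm C}y$ means $U(x)=U(L(x,y),L(x,y'))$; the commutator is the set $c(x,y)=\operatorname{Min}U(L(x,y),L(x,y'),L(x',y),L(x',y'))$; for $A\subseteq P$, $A'=\{x'\mid x\in A\}$; and $$t(x,y,z)=\operatorname{Min}U\Big(L\big((c(x,y))',x\big),\,L\big(c(x,y),z\big)\Big)$$ for all $x,y,z\in P$. (The letter $c$ denotes the commutator when written $c(\cdot,\cdot)$ and an element of $P$ otherwise.) *)

theory Defs
  imports "HOL-Algebra.Order"
begin

text \<open>
  A poset with a unary operation is a partial order of HOL-Algebra (where the field
  \<^term>\<open>eq\<close> is genuine equality) with one further field. The cones $L(A)$ and $U(A)$ are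
  \<^term>\<open>Lower P A\<close> and \<^term>\<open>Upper P A\<close>; $0$ and $1$ are \<^term>\<open>bottom P\<close> and \<^term>\<open>top P\<close>,
  which are meaningful in a bounded poset. Commas between elements or subsets become unions.
\<close>

record 'a cposet = "'a gorder" +
  compl :: "'a \<Rightarrow> 'a"  (\<open>_\<acute>\<index>\<close> [999] 999)

locale bounded_poset =
  partial_order P + weak_partial_order_bottom P + weak_partial_order_top P
  for P (structure)

definition antitone_involution :: "('a, 'm) cposet_scheme \<Rightarrow> bool"
  where "antitone_involution P \<longleftrightarrow>
    (\<forall>x\<in>carrier P. x\<acute>\<^bsub>P\<^esub> \<in> carrier P \<and> x\<acute>\<^bsub>P\<^esub>\<acute>\<^bsub>P\<^esub> = x) \<and>
    (\<forall>x\<in>carrier P. \<forall>y\<in>carrier P. x \<sqsubseteq>\<^bsub>P\<^esub> y \<longrightarrow> y\<acute>\<^bsub>P\<^esub> \<sqsubseteq>\<^bsub>P\<^esub> x\<acute>\<^bsub>P\<^esub>)"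

definition complementation :: "('a, 'm) cposet_scheme \<Rightarrow> bool"
  where "complementation P \<longleftrightarrow>
    (\<forall>x\<in>carrier P. x\<acute>\<^bsub>P\<^esub> \<in> carrier P \<and>
      Lower P {x, x\<acute>\<^bsub>P\<^esub>} = {\<bottom>\<^bsub>P\<^esub>} \<and> Upper P {x, x\<acute>\<^bsub>P\<^esub>} = {\<top>\<^bsub>P\<^esub>})"

definition distributive_poset :: "('a, 'm) gorder_scheme \<Rightarrow> bool"
  where "distributive_poset P \<longleftrightarrow> partial_order P \<and>
    (\<forall>x\<in>carrier P. \<forall>y\<in>carrier P. \<forall>z\<in>carrier P.
      Lower P (Upper P {x, y} \<union> {z}) = Lower P (Upper P (Lower P {x, z} \<union> Lower P {y, z})))"

locale involution_poset = bounded_poset P for P (structure) +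
  assumes antitone_involution: "antitone_involution P"

locale boolean_poset = bounded_poset P for P (structure) +
  assumes distributive: "distributive_poset P"
    and complementation: "complementation P"

locale generalized_orthomodular_poset = involution_poset P for P (structure) +
  assumes complementation: "complementation P"
    and orthomodular: "\<And>x y. \<lbrakk>x \<in> carrier P; y \<in> carrier P; x \<sqsubseteq> y\<rbrakk> \<Longrightarrow>
      Upper P {y} = Upper P ({x} \<union> Lower P {y, x\<acute>})"

text \<open>
  The horizontal sum of a family is determined up to isomorphism only. A poset \<open>P\<close> is a
  horizontal sum of the posets \<open>B i\<close>, \<open>i \<in> I\<close>, if it is the union of isomorphic copies
  \<open>e i ` carrier (B i)\<close> that are disjoint except that all bottoms are identified with \<open>0\<close> and all
  tops with \<open>1\<close>, and its order and operation are those inherited from the copies; in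
  particular elements are comparable only if they lie in a common copy.
  (That \<open>e i\<close> is injective follows from \<^const>\<open>order_emb\<close>.)
\<close>

definition horizontal_sum :: "('a, 'm) cposet_scheme \<Rightarrow> 'i set \<Rightarrow> ('i \<Rightarrow> ('b, 'n) cposet_scheme) \<Rightarrow> bool"
  where "horizontal_sum P I B \<longleftrightarrow>
    involution_poset P \<and> I \<noteq> {} \<and> (\<forall>i\<in>I. involution_poset (B i)) \<and>
    (\<exists>e. (\<forall>i\<in>I. order_emb (B i) P (e i) \<and>
              e i \<bottom>\<^bsub>B i\<^esub> = \<bottom>\<^bsub>P\<^esub> \<and> e i \<top>\<^bsub>B i\<^esub> = \<top>\<^bsub>P\<^esub> \<and>
              (\<forall>x\<in>carrier (B i). e i (x\<acute>\<^bsub>B i\<^esub>) = (e i x)\<acute>\<^bsub>P\<^esub>)) \<and>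
         carrier P = (\<Union>i\<in>I. e i ` carrier (B i)) \<and>
         (\<forall>i\<in>I. \<forall>j\<in>I. i \<noteq> j \<longrightarrow> e i ` carrier (B i) \<inter> e j ` carrier (B j) = {\<bottom>\<^bsub>P\<^esub>, \<top>\<^bsub>P\<^esub>}) \<and>
         (\<forall>x\<in>carrier P. \<forall>y\<in>carrier P. x \<sqsubseteq>\<^bsub>P\<^esub> y \<longrightarrow>
            (\<exists>i\<in>I. x \<in> e i ` carrier (B i) \<and> y \<in> e i ` carrier (B i))))"

text \<open>
  Boolean posets qualify as summands: their complementation is an antitone involution.
\<close>

lemma boolean_poset_imp_involution_poset:
  assumes "boolean_poset P"
  shows "involution_poset P"
proof -
  interpret boolean_poset P by (rule assms)
  have closed: "x\<acute>\<^bsub>P\<^esub> \<in> carrier P"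
    and L: "Lower P {x, x\<acute>\<^bsub>P\<^esub>} = {\<bottom>\<^bsub>P\<^esub>}" and U: "Upper P {x, x\<acute>\<^bsub>P\<^esub>} = {\<top>\<^bsub>P\<^esub>}"
    if "x \<in> carrier P" for x
    using complementation that by (auto simp: complementation_def)
  have dist: "Lower P (Upper P {x, y} \<union> {z}) = Lower P (Upper P (Lower P {x, z} \<union> Lower P {y, z}))"
    if "x \<in> carrier P" "y \<in> carrier P" "z \<in> carrier P" for x y z
    using distributive that by (auto simp: distributive_poset_def)
  have key: "z \<sqsubseteq>\<^bsub>P\<^esub> y"
    if x: "x \<in> carrier P" and y: "y \<in> carrier P" and z: "z \<in> carrier P"
      and top: "Upper P {x, y} = {\<top>\<^bsub>P\<^esub>}" and bot: "Lower P {x, z} = {\<bottom>\<^bsub>P\<^esub>}" for x y z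
  proof -
    have "z \<in> Lower P (Upper P {x, y} \<union> {z})"
      using z by (auto simp: top Lower_def)
    then have "z \<in> Lower P (Upper P ({\<bottom>\<^bsub>P\<^esub>} \<union> Lower P {y, z}))"
      using dist[OF x y z] bot by simp
    moreover have "y \<in> Upper P ({\<bottom>\<^bsub>P\<^esub>} \<union> Lower P {y, z})"
      using y by (auto simp: Upper_def Lower_def)
    ultimately show "z \<sqsubseteq>\<^bsub>P\<^esub> y"
      using y unfolding Lower_def[of P "Upper P _"] by blast
  qed
  have inv: "x\<acute>\<^bsub>P\<^esub>\<acute>\<^bsub>P\<^esub> = x" if x: "x \<in> carrier P" for x
  proof (rule le_antisym)
    show "x\<acute>\<^bsub>P\<^esub>\<acute>\<^bsub>P\<^esub> \<sqsubseteq>\<^bsub>P\<^esub> x"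
      using key[of "x\<acute>\<^bsub>P\<^esub>" x "x\<acute>\<^bsub>P\<^esub>\<acute>\<^bsub>P\<^esub>"] L[of "x\<acute>\<^bsub>P\<^esub>"] U[OF x] closed x
      by (simp add: insert_commute)
    show "x \<sqsubseteq>\<^bsub>P\<^esub> x\<acute>\<^bsub>P\<^esub>\<acute>\<^bsub>P\<^esub>"
      using key[of "x\<acute>\<^bsub>P\<^esub>" "x\<acute>\<^bsub>P\<^esub>\<acute>\<^bsub>P\<^esub>" x] U[of "x\<acute>\<^bsub>P\<^esub>"] L[OF x] closed x
      by (simp add: insert_commute)
  qed (use closed x in auto)
  have anti: "y\<acute>\<^bsub>P\<^esub> \<sqsubseteq>\<^bsub>P\<^esub> x\<acute>\<^bsub>P\<^esub>"
    if x: "x \<in> carrier P" and y: "y \<in> carrier P" and xy: "x \<sqsubseteq>\<^bsub>P\<^esub> y" for x y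
  proof -
    have "Lower P {x, y\<acute>\<^bsub>P\<^esub>} \<subseteq> Lower P {y, y\<acute>\<^bsub>P\<^esub>}"
    proof
      fix w assume "w \<in> Lower P {x, y\<acute>\<^bsub>P\<^esub>}"
      then have w: "w \<in> carrier P" "w \<sqsubseteq>\<^bsub>P\<^esub> x" "w \<sqsubseteq>\<^bsub>P\<^esub> y\<acute>\<^bsub>P\<^esub>"
        using x closed[OF y] by (auto simp: Lower_def)
      then have "w \<sqsubseteq>\<^bsub>P\<^esub> y"
        using le_trans[of w x y] xy x y by blast
      with w show "w \<in> Lower P {y, y\<acute>\<^bsub>P\<^esub>}"
        unfolding Lower_def by blast
    qed
    moreover have "\<bottom>\<^bsub>P\<^esub> \<in> Lower P {x, y\<acute>\<^bsub>P\<^esub>}"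
      using x closed[OF y] by (auto simp: Lower_def)
    ultimately have "Lower P {x, y\<acute>\<^bsub>P\<^esub>} = {\<bottom>\<^bsub>P\<^esub>}" using L[OF y] by auto
    then show ?thesis using key[of x "x\<acute>\<^bsub>P\<^esub>" "y\<acute>\<^bsub>P\<^esub>"] x closed[OF x] closed[OF y] U[OF x] by simp
  qed
  show ?thesis
    by unfold_locales (simp add: antitone_involution_def closed inv anti)
qed

definition Min_elems :: "('a, 'm) gorder_scheme \<Rightarrow> 'a set \<Rightarrow> 'a set"
  where "Min_elems P A = {x \<in> A. \<not> (\<exists>y\<in>A. y \<sqsubset>\<^bsub>P\<^esub> x)}"

definition commutes :: "('a, 'm) cposet_scheme \<Rightarrow> 'a \<Rightarrow> 'a \<Rightarrow> bool"
  where "commutes P x y \<longleftrightarrow>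
    Upper P {x} = Upper P (Lower P {x, y} \<union> Lower P {x, y\<acute>\<^bsub>P\<^esub>})"

definition commutator :: "('a, 'm) cposet_scheme \<Rightarrow> 'a \<Rightarrow> 'a \<Rightarrow> 'a set"
  where "commutator P x y =
    Min_elems P (Upper P (Lower P {x, y} \<union> Lower P {x, y\<acute>\<^bsub>P\<^esub>} \<union>
                          Lower P {x\<acute>\<^bsub>P\<^esub>, y} \<union> Lower P {x\<acute>\<^bsub>P\<^esub>, y\<acute>\<^bsub>P\<^esub>}))"

text \<open>The term $t(x,y,z)$ is a set; an equation $t(x,y,z) = w$ means \<open>t_term P x y z = {w}\<close>.\<close>

definition t_term :: "('a, 'm) cposet_scheme \<Rightarrow> 'a \<Rightarrow> 'a \<Rightarrow> 'a \<Rightarrow> 'a set"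
  where "t_term P x y z =
    Min_elems P (Upper P (Lower P (compl P ` commutator P x y \<union> {x}) \<union>
                          Lower P (commutator P x y \<union> {z})))"

end

theory Submission
  imports Defs
begin

text \<open>
  Two elements commute precisely when they lie in a common block. Inside a block distributivity
  yields \<open>U(x) = U(L(x,y), L(x,y'))\<close>, so the commutator is \<open>Min U(x,x') = 1\<close> and the term
  collapses to \<open>Min U(0, L(z)) = z\<close>. Elements of different blocks have only trivial lower bounds,
  so the commutator is \<open>0\<close> and the term collapses to \<open>Min U(L(x), 0) = x\<close>.
\<close>

text \<open>Distributivity applied to y, y' and x: since U(y,y') = {1}, the element x lies in
  LU(L(y,x), L(y',x)), and the hypotheses put u into the inner upper cone. Stating them elementwise
  instead of by cones makes the result easy to carry along an order embedding.\<close>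

lemma (in boolean_poset) le_if_bounds_meets:
  assumes "x \<in> carrier P" "y \<in> carrier P" "u \<in> carrier P"
    and "\<And>w. \<lbrakk>w \<in> carrier P; w \<sqsubseteq> x; w \<sqsubseteq> y\<rbrakk> \<Longrightarrow> w \<sqsubseteq> u"
    and "\<And>w. \<lbrakk>w \<in> carrier P; w \<sqsubseteq> x; w \<sqsubseteq> y\<acute>\<rbrakk> \<Longrightarrow> w \<sqsubseteq> u"
  shows "x \<sqsubseteq> u"
proof -
  have y': "y\<acute> \<in> carrier P" and U: "Upper P {y, y\<acute>} = {\<top>}"
    using complementation assms(2) by (auto simp: complementation_def)
  have "x \<in> Lower P (Upper P {y, y\<acute>} \<union> {x})"
    unfolding U using assms(1) by (auto simp: Lower_def)
  then have "x \<in> Lower P (Upper P (Lower P {y, x} \<union> Lower P {y\<acute>, x}))"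
    using distributive assms(1,2) y' by (auto simp: distributive_poset_def)
  moreover have "u \<in> Upper P (Lower P {y, x} \<union> Lower P {y\<acute>, x})"
    using assms y' by (auto simp: Upper_def Lower_def)
  ultimately show ?thesis
    using assms(3) unfolding Lower_def[of P "Upper P _"] by blast
qed

text \<open>An internal view of the horizontal sum: the summands become subsets of the carrier, so
  that index set, embeddings and the second element type disappear. \<open>block_le\<close> is all
  that remains of the Boolean structure of a summand; its test elements w and its bound u range over
  the block S only, as cones inside S may be smaller than cones in P.\<close>

locale boolean_blocks = bounded_poset P for P (structure) +
  fixes \<B> :: "'a set set"
  assumes complementation: "complementation P"
    and compl_compl: "x \<in> carrier P \<Longrightarrow> x\<acute>\<acute> = x"
    and Union_blocks: "\<Union>\<B> = carrier P"
    and bottom_block: "S \<in> \<B> \<Longrightarrow> \<bottom> \<in> S"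
    and top_block: "S \<in> \<B> \<Longrightarrow> \<top> \<in> S"
    and compl_block: "\<lbrakk>S \<in> \<B>; x \<in> S\<rbrakk> \<Longrightarrow> x\<acute> \<in> S"
    and blocks_Int: "\<lbrakk>S \<in> \<B>; T \<in> \<B>; S \<noteq> T\<rbrakk> \<Longrightarrow> S \<inter> T \<subseteq> {\<bottom>, \<top>}"
    and le_block: "\<lbrakk>x \<in> carrier P; y \<in> carrier P; x \<sqsubseteq> y\<rbrakk> \<Longrightarrow> \<exists>S\<in>\<B>. x \<in> S \<and> y \<in> S"
    and block_le: "\<lbrakk>S \<in> \<B>; x \<in> S; y \<in> S; u \<in> S;
      \<And>w. \<lbrakk>w \<in> S; w \<sqsubseteq> x; w \<sqsubseteq> y\<rbrakk> \<Longrightarrow> w \<sqsubseteq> u; \<And>w. \<lbrakk>w \<in> S; w \<sqsubseteq> x; w \<sqsubseteq> y\<acute>\<rbrakk> \<Longrightarrow> w \<sqsubseteq> u\<rbrakk> \<Longrightarrow> x \<sqsubseteq> u"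
begin

lemma compl_closed: "x \<in> carrier P \<Longrightarrow> x\<acute> \<in> carrier P"
  using complementation by (simp add: complementation_def)

lemma block_closed: "\<lbrakk>S \<in> \<B>; x \<in> S\<rbrakk> \<Longrightarrow> x \<in> carrier P"
  using Union_blocks by blast

lemma top_le_eq: "\<lbrakk>x \<in> carrier P; \<top> \<sqsubseteq> x\<rbrakk> \<Longrightarrow> x = \<top>"
  using le_antisym[of x \<top>] top_higher by auto

lemma le_bottom_eq: "\<lbrakk>x \<in> carrier P; x \<sqsubseteq> \<bottom>\<rbrakk> \<Longrightarrow> x = \<bottom>"
  using le_antisym[of x \<bottom>] bottom_lower by auto

text \<open>The element 0' is an upper bound of both 0 and 0', and U(0,0') = {1}.\<close>

lemma compl_bottom: "\<bottom>\<acute> = \<top>"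
proof -
  have "\<bottom>\<acute> \<in> Upper P {\<bottom>, \<bottom>\<acute>}"
    using compl_closed[OF bottom_closed] bottom_lower by (auto simp: Upper_def)
  then show ?thesis
    using complementation by (simp add: complementation_def)
qed

lemma compl_top: "\<top>\<acute> = \<bottom>"
  using compl_compl[OF bottom_closed] compl_bottom by simp

text \<open>The cones are formed in all of P, whereas \<open>block_le\<close> handles only bounds u
  inside S. A bound u outside S is above no element of S other than 0, and this forces x =
  0.\<close>

lemma Upper_eq_Upper_meets:
  assumes S: "S \<in> \<B>" "x \<in> S" "y \<in> S"
  shows "Upper P (Lower P {x, y} \<union> Lower P {x, y\<acute>}) = Upper P {x}"
proof (intro equalityI subsetI)
  have car: "x \<in> carrier P" "y \<in> carrier P" "y\<acute> \<in> carrier P"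
    using S block_closed compl_closed by auto
  fix u assume u: "u \<in> Upper P (Lower P {x, y} \<union> Lower P {x, y\<acute>})"
  then have uc: "u \<in> carrier P" by (auto simp: Upper_def)
  have ub: "w \<sqsubseteq> u" if "w \<in> S" "w \<sqsubseteq> x" "w \<sqsubseteq> y \<or> w \<sqsubseteq> y\<acute>" for w
    using u that block_closed[OF S(1)] car by (auto simp: Upper_def Lower_def)
  have "x \<sqsubseteq> u"
  proof (cases "u \<in> S")
    case True
    then show ?thesis using block_le[OF S, of u] ub by blast
  next
    case False
    have "w \<sqsubseteq> \<bottom>" if w: "w \<in> S" "w \<sqsubseteq> x" "w \<sqsubseteq> y \<or> w \<sqsubseteq> y\<acute>" for w
    proof -
      have wc: "w \<in> carrier P" using w(1) S(1) block_closed by blast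
      \<comment> \<open>Comparability of w and u gives them a common block T, which differs from S
        because u is not in S. Hence w is 0 or 1, and w = 1 would give u = 1, an element of
        S.\<close>
      obtain T where "T \<in> \<B>" "w \<in> T" "u \<in> T"
        using le_block[OF wc uc ub[OF w]] by blast
      then have "w = \<bottom> \<or> w = \<top>"
        using blocks_Int[of S T] S(1) w(1) False by blast
      moreover have "w \<noteq> \<top>"
        using top_le_eq[OF uc] ub[OF w] False top_block[OF S(1)] by auto
      ultimately show ?thesis by simp
    qed
    \<comment> \<open>The bound u cannot be used in \<open>block_le\<close>, but 0 lies in S and now
      bounds the same test elements.\<close>
    then have "x \<sqsubseteq> \<bottom>"
      using block_le[OF S bottom_block[OF S(1)]] by blast
    then show ?thesis using le_bottom_eq car(1) uc bottom_lower by auto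
  qed
  then show "u \<in> Upper P {x}" using uc by (auto simp: Upper_def)
next
  fix u assume "u \<in> Upper P {x}"
  then show "u \<in> Upper P (Lower P {x, y} \<union> Lower P {x, y\<acute>})"
    using S block_closed[OF S(1)] le_trans[of _ x u] by (auto simp: Upper_def Lower_def)
qed

text \<open>A common lower bound w shares a block S with x and a block T with y. These blocks
  differ, so w is 0 or 1; but w = 1 would give x = 1, placing x in T together with y.\<close>

lemma Lower_eq_bottom:
  assumes x: "x \<in> carrier P" and y: "y \<in> carrier P" and "\<not> (\<exists>S\<in>\<B>. x \<in> S \<and> y \<in> S)"
  shows "Lower P {x, y} = {\<bottom>}"
proof (intro equalityI subsetI)
  fix w assume "w \<in> Lower P {x, y}"
  then have w: "w \<in> carrier P" "w \<sqsubseteq> x" "w \<sqsubseteq> y" using x y by (auto simp: Lower_def)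
  obtain S T where "S \<in> \<B>" "w \<in> S" "x \<in> S" "T \<in> \<B>" "w \<in> T" "y \<in> T"
    using le_block w x y by meson
  then have "w = \<bottom> \<or> w = \<top>" "\<top> \<in> T"
    using blocks_Int[of S T] assms(3) top_block by blast+
  moreover have "w \<noteq> \<top>"
    using top_le_eq[OF x] w(2) assms(3) \<open>T \<in> \<B>\<close> \<open>y \<in> T\<close> \<open>\<top> \<in> T\<close> by auto
  ultimately show "w \<in> {\<bottom>}" by simp
qed (use x y bottom_lower in \<open>auto simp: Lower_def\<close>)

text \<open>Blocks are closed under complements and y'' = y, so a block containing y' also contains
  y.\<close>

lemma not_common_block_compl:
  assumes "y \<in> carrier P" "\<not> (\<exists>S\<in>\<B>. x \<in> S \<and> y \<in> S)"
  shows "\<not> (\<exists>S\<in>\<B>. x \<in> S \<and> y\<acute> \<in> S)"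
proof
  assume "\<exists>S\<in>\<B>. x \<in> S \<and> y\<acute> \<in> S"
  then obtain S where "S \<in> \<B>" "x \<in> S" "y\<acute> \<in> S" by blast
  then show False
    using compl_block[of S "y\<acute>"] compl_compl[OF assms(1)] assms(2) by auto
qed

lemma Upper_bottom: "Upper P {\<bottom>} = carrier P"
  using bottom_lower by (auto simp: Upper_def)

lemma Min_elems_Upper_singleton:
  assumes "x \<in> carrier P"
  shows "Min_elems P (Upper P {x}) = {x}"
  using assms le_antisym by (auto simp: Min_elems_def Upper_def lless_eq)

lemma commutes_iff_common_block:
  assumes x: "x \<in> carrier P" and y: "y \<in> carrier P"
  shows "commutes P x y \<longleftrightarrow> (\<exists>S\<in>\<B>. x \<in> S \<and> y \<in> S)"
proof
  show "commutes P x y" if "\<exists>S\<in>\<B>. x \<in> S \<and> y \<in> S"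
    using that Upper_eq_Upper_meets by (auto simp: commutes_def)
  show "\<exists>S\<in>\<B>. x \<in> S \<and> y \<in> S" if "commutes P x y"
  proof (rule ccontr)
    assume no: "\<not> (\<exists>S\<in>\<B>. x \<in> S \<and> y \<in> S)"
    \<comment> \<open>Both cones in the definition of \<open>commutes\<close> reduce to {0}. Hence x
      is below everything, so x = 0, which lies in every block, in particular in one containing
      y.\<close>
    have "Upper P {x} = carrier P"
      using that Lower_eq_bottom[OF x y no]
        Lower_eq_bottom[OF x compl_closed[OF y] not_common_block_compl[OF y no]]
      by (simp add: commutes_def Upper_bottom)
    then have "x = \<bottom>"
      using le_bottom_eq[OF x] x bottom_closed by (auto simp: Upper_def)
    moreover obtain S where "S \<in> \<B>" "y \<in> S" using y Union_blocks by blast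
    ultimately show False using no bottom_block by blast
  qed
qed

lemma commutator_common_block:
  assumes S: "S \<in> \<B>" "x \<in> S" "y \<in> S"
  shows "commutator P x y = {\<top>}"
proof -
  have x: "x \<in> carrier P" using S block_closed by blast
  have Un: "Upper P (A \<union> A') = Upper P A \<inter> Upper P A'" for A A'
    by (auto simp: Upper_def)
  \<comment> \<open>The four cones are grouped in pairs, one for x and one for x'; each pair has the
    form treated in \<open>Upper_eq_Upper_meets\<close>, as x' lies in S too.\<close>
  have "Upper P (Lower P {x, y} \<union> Lower P {x, y\<acute>} \<union> (Lower P {x\<acute>, y} \<union> Lower P {x\<acute>, y\<acute>}))
      = Upper P {x} \<inter> Upper P {x\<acute>}"
    unfolding Un[of "_ \<union> _" "_ \<union> _"] using Upper_eq_Upper_meets S compl_block by simp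
  also have "\<dots> = Upper P {x, x\<acute>}"
    unfolding Un[symmetric] by (simp add: insert_commute)
  also have "\<dots> = {\<top>}"
    using complementation x by (simp add: complementation_def)
  finally show ?thesis
    by (auto simp: commutator_def Un_assoc Min_elems_def lless_eq)
qed

text \<open>Complementing either argument cannot create a common block, so all four lower cones are
  {0} and the commutator is Min U(0).\<close>

lemma commutator_no_common_block:
  assumes x: "x \<in> carrier P" and y: "y \<in> carrier P" and no: "\<not> (\<exists>S\<in>\<B>. x \<in> S \<and> y \<in> S)"
  shows "commutator P x y = {\<bottom>}"
proof -
  \<comment> \<open>\<open>not_common_block_compl\<close> is used with the roles of x and y
    exchanged.\<close>
  have no': "\<not> (\<exists>S\<in>\<B>. x\<acute> \<in> S \<and> y \<in> S)"
    using not_common_block_compl[OF x, of y] no by blast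
  show ?thesis
    using Lower_eq_bottom x y no no' not_common_block_compl[OF y] compl_closed
      Min_elems_Upper_singleton[OF bottom_closed]
    by (simp add: commutator_def)
qed

text \<open>This lemma and the next evaluate the two lower cones in t once the commutator is known
  to be {0} or {1}: one cone keeps its element, the other becomes {0}.\<close>

lemma Lower_top_insert: "x \<in> carrier P \<Longrightarrow> Lower P {x, \<top>} = Lower P {x}"
  using top_higher by (auto simp: Lower_def)

lemma Lower_bottom_insert: "x \<in> carrier P \<Longrightarrow> Lower P {x, \<bottom>} = {\<bottom>}"
  using bottom_lower le_bottom_eq by (auto simp: Lower_def)

text \<open>Absorbs the 0 that the trivial cone contributes to t; the other cone L(x) has x as its
  greatest element.\<close>

lemma Upper_insert_bottom_Lower:
  assumes "x \<in> carrier P"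
  shows "Upper P (insert \<bottom> (Lower P {x})) = Upper P {x}"
proof (intro equalityI subsetI)
  fix u assume "u \<in> Upper P (insert \<bottom> (Lower P {x}))"
  moreover have "x \<in> Lower P {x}" using assms by (auto simp: Lower_def)
  ultimately show "u \<in> Upper P {x}" using assms by (auto simp: Upper_def)
next
  fix u assume "u \<in> Upper P {x}"
  then have "u \<in> carrier P" "x \<sqsubseteq> u" using assms by (auto simp: Upper_def)
  then show "u \<in> Upper P (insert \<bottom> (Lower P {x}))"
    using assms le_trans[of _ x u] by (auto simp: Upper_def Lower_def)
qed

lemma t_term_eq:
  assumes "x \<in> carrier P" "y \<in> carrier P" "z \<in> carrier P"
  shows "t_term P x y z = (if commutes P x y then {z} else {x})"
proof (cases "\<exists>S\<in>\<B>. x \<in> S \<and> y \<in> S")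
  case True
  then have "commutator P x y = {\<top>}" using commutator_common_block by blast
  then show ?thesis
    using True assms commutes_iff_common_block
    by (simp add: t_term_def compl_top Lower_top_insert Lower_bottom_insert
        Upper_insert_bottom_Lower Min_elems_Upper_singleton)
next
  case False
  then have "commutator P x y = {\<bottom>}" using commutator_no_common_block assms by blast
  then show ?thesis
    using False assms commutes_iff_common_block
    by (auto simp: t_term_def compl_bottom Lower_top_insert Lower_bottom_insert
        Upper_insert_bottom_Lower Min_elems_Upper_singleton)
qed

end

text \<open>The blocks are the images of the summands. Order and complement inside a block are
  computed in the summand, because each \<open>e i\<close> is an order embedding that commutes with
  complementation.\<close>

lemma horizontal_sum_imp_boolean_blocks:
  fixes P :: "('a, 'm) cposet_scheme" and B :: "'i \<Rightarrow> ('b, 'n) cposet_scheme"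
  assumes "complementation P" and boolean: "\<And>i. i \<in> I \<Longrightarrow> boolean_poset (B i)"
    and sum: "horizontal_sum P I B"
  obtains \<B> where "boolean_blocks P \<B>"
proof -
  obtain e where e: "\<forall>i\<in>I. order_emb (B i) P (e i) \<and>
        e i \<bottom>\<^bsub>B i\<^esub> = \<bottom>\<^bsub>P\<^esub> \<and> e i \<top>\<^bsub>B i\<^esub> = \<top>\<^bsub>P\<^esub> \<and>
        (\<forall>x\<in>carrier (B i). e i (x\<acute>\<^bsub>B i\<^esub>) = (e i x)\<acute>\<^bsub>P\<^esub>)"
    and car: "carrier P = (\<Union>i\<in>I. e i ` carrier (B i))"
    and disj: "\<forall>i\<in>I. \<forall>j\<in>I. i \<noteq> j \<longrightarrow>
      e i ` carrier (B i) \<inter> e j ` carrier (B j) = {\<bottom>\<^bsub>P\<^esub>, \<top>\<^bsub>P\<^esub>}"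
    and comparable: "\<forall>x\<in>carrier P. \<forall>y\<in>carrier P. x \<sqsubseteq>\<^bsub>P\<^esub> y \<longrightarrow>
      (\<exists>i\<in>I. x \<in> e i ` carrier (B i) \<and> y \<in> e i ` carrier (B i))"
    using sum unfolding horizontal_sum_def by (elim conjE exE) (rule that)
  have emb: "order_emb (B i) P (e i)"
    and bot: "e i \<bottom>\<^bsub>B i\<^esub> = \<bottom>\<^bsub>P\<^esub>" and top: "e i \<top>\<^bsub>B i\<^esub> = \<top>\<^bsub>P\<^esub>"
    and com: "x \<in> carrier (B i) \<Longrightarrow> e i (x\<acute>\<^bsub>B i\<^esub>) = (e i x)\<acute>\<^bsub>P\<^esub>"
    if "i \<in> I" for i x
    using e that by blast+
  interpret involution_poset P using sum by (simp add: horizontal_sum_def)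
  have bounded: "bounded_poset (B i)" if "i \<in> I" for i
    using boolean[OF that] by (simp add: boolean_poset_def)
  have le_iff: "e i x \<sqsubseteq>\<^bsub>P\<^esub> e i y \<longleftrightarrow> x \<sqsubseteq>\<^bsub>B i\<^esub> y"
    if "i \<in> I" "x \<in> carrier (B i)" "y \<in> carrier (B i)" for i x y
    using emb[OF that(1)] that by (simp add: order_emb_def)
  have compl_B: "x\<acute>\<^bsub>B i\<^esub> \<in> carrier (B i)" if "i \<in> I" "x \<in> carrier (B i)" for i x
    using boolean_poset.complementation[OF boolean[OF that(1)]] that(2)
    by (simp add: complementation_def)
  have "boolean_blocks P ((\<lambda>i. e i ` carrier (B i)) ` I)" (is "boolean_blocks P ?\<B>")
  proof unfold_locales
    show "complementation P" by fact
    show "x\<acute>\<^bsub>P\<^esub>\<acute>\<^bsub>P\<^esub> = x" if "x \<in> carrier P" for x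
      using antitone_involution that by (simp add: antitone_involution_def)
    show "\<Union>?\<B> = carrier P" using car by simp
    show "\<bottom>\<^bsub>P\<^esub> \<in> S" "\<top>\<^bsub>P\<^esub> \<in> S" if S: "S \<in> ?\<B>" for S
    proof -
      obtain i where i: "i \<in> I" "S = e i ` carrier (B i)" using S by blast
      interpret Bi: bounded_poset "B i" by (rule bounded[OF i(1)])
      show "\<bottom>\<^bsub>P\<^esub> \<in> S" "\<top>\<^bsub>P\<^esub> \<in> S"
        using bot[OF i(1)] top[OF i(1)] Bi.bottom_closed Bi.top_closed i(2) by (metis imageI)+
    qed
    show "x\<acute>\<^bsub>P\<^esub> \<in> S" if S: "S \<in> ?\<B>" "x \<in> S" for S x
    proof -
      obtain i v where "i \<in> I" "S = e i ` carrier (B i)" "v \<in> carrier (B i)" "x = e i v"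
        using S by blast
      then show ?thesis using com[of i v] compl_B[of i v] by (metis imageI)
    qed
    show "S \<inter> T \<subseteq> {\<bottom>\<^bsub>P\<^esub>, \<top>\<^bsub>P\<^esub>}" if ST: "S \<in> ?\<B>" "T \<in> ?\<B>" "S \<noteq> T" for S T
    proof -
      obtain i j where "i \<in> I" "j \<in> I" "S = e i ` carrier (B i)" "T = e j ` carrier (B j)"
        using ST by blast
      \<comment> \<open>Distinct images come from distinct indices, so \<open>disj\<close>
        applies.\<close>
      then have "S \<inter> T = {\<bottom>\<^bsub>P\<^esub>, \<top>\<^bsub>P\<^esub>}"
        using disj \<open>S \<noteq> T\<close> by metis
      then show ?thesis by simp
    qed
    show "\<exists>S\<in>?\<B>. x \<in> S \<and> y \<in> S" if "x \<in> carrier P" "y \<in> carrier P" "x \<sqsubseteq>\<^bsub>P\<^esub> y" for x y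
      unfolding bex_simps(7) using comparable[rule_format, OF that] .
    show "x \<sqsubseteq>\<^bsub>P\<^esub> u"
      if S: "S \<in> ?\<B>" and mem: "x \<in> S" "y \<in> S" "u \<in> S"
        and le: "\<And>w. \<lbrakk>w \<in> S; w \<sqsubseteq>\<^bsub>P\<^esub> x; w \<sqsubseteq>\<^bsub>P\<^esub> y\<rbrakk> \<Longrightarrow> w \<sqsubseteq>\<^bsub>P\<^esub> u"
        and le': "\<And>w. \<lbrakk>w \<in> S; w \<sqsubseteq>\<^bsub>P\<^esub> x; w \<sqsubseteq>\<^bsub>P\<^esub> y\<acute>\<^bsub>P\<^esub>\<rbrakk> \<Longrightarrow> w \<sqsubseteq>\<^bsub>P\<^esub> u" for S x y u
    proof -
      obtain i where i: "i \<in> I" "S = e i ` carrier (B i)" using S by blast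
      \<comment> \<open>The claim is pulled back to the summand \<open>B i\<close>, where
        \<open>le_if_bounds_meets\<close> is available; each test element w there is mapped into S,
        so that \<open>le\<close> and \<open>le'\<close> can be applied to
        \<open>e i w\<close>.\<close>
      obtain p q r where pqr: "p \<in> carrier (B i)" "q \<in> carrier (B i)" "r \<in> carrier (B i)"
        and eqs: "x = e i p" "y = e i q" "u = e i r"
        using mem i(2) by blast
      interpret Bi: boolean_poset "B i" by (rule boolean[OF i(1)])
      have "p \<sqsubseteq>\<^bsub>B i\<^esub> r"
      proof (rule Bi.le_if_bounds_meets[OF pqr])
        fix w assume w: "w \<in> carrier (B i)" "w \<sqsubseteq>\<^bsub>B i\<^esub> p"
        then have mem: "e i w \<in> S" and wx: "e i w \<sqsubseteq>\<^bsub>P\<^esub> x"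
          using i le_iff[OF i(1) w(1) pqr(1)] eqs(1) by simp_all
        have wu: "e i w \<sqsubseteq>\<^bsub>P\<^esub> u \<longleftrightarrow> w \<sqsubseteq>\<^bsub>B i\<^esub> r"
          unfolding eqs(3) by (rule le_iff[OF i(1) w(1) pqr(3)])
        show "w \<sqsubseteq>\<^bsub>B i\<^esub> r" if "w \<sqsubseteq>\<^bsub>B i\<^esub> q"
        proof -
          have "e i w \<sqsubseteq>\<^bsub>P\<^esub> y"
            unfolding eqs(2) using le_iff[OF i(1) w(1) pqr(2)] that by simp
          then show ?thesis using le[OF mem wx] wu by iprover
        qed
        show "w \<sqsubseteq>\<^bsub>B i\<^esub> r" if "w \<sqsubseteq>\<^bsub>B i\<^esub> q\<acute>\<^bsub>B i\<^esub>"
        proof -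
          have "e i w \<sqsubseteq>\<^bsub>P\<^esub> y\<acute>\<^bsub>P\<^esub>"
            \<comment> \<open>The complement taken in P is rewritten as the image of the complement
              taken in \<open>B i\<close>, which brings the inequality into the form of
              \<open>le_iff\<close>.\<close>
            unfolding eqs(2) com[OF i(1) pqr(2), symmetric]
            using le_iff[OF i(1) w(1) compl_B[OF i(1) pqr(2)]] that by simp
          then show ?thesis using le'[OF mem wx] wu by iprover
        qed
      qed
      then show ?thesis using le_iff i(1) pqr eqs by simp
    qed
  qed
  then show thesis by (rule that)
qed

theorem theorem4p15:
  fixes P :: "'a cposet" and I :: "'i set" and B :: "'i \<Rightarrow> 'b cposet"
    and a b c :: 'a
  assumes "generalized_orthomodular_poset P"
    and "\<And>i. i \<in> I \<Longrightarrow> boolean_poset (B i)"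
    and "horizontal_sum P I B"
    and "a \<in> carrier P" and "b \<in> carrier P" and "c \<in> carrier P"
  shows "t_term P a b c = (if commutes P a b then {c} else {a})"
proof -
  obtain \<B> where "boolean_blocks P \<B>"
    using horizontal_sum_imp_boolean_blocks
      generalized_orthomodular_poset.complementation[OF assms(1)] assms(2,3) by blast
  then show ?thesis
    using assms(4-6) by (rule boolean_blocks.t_term_eq)
qed

end
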